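(* Let $\Omega\subset\mathbb{R}^n$ be a non-empty open convex set. Suppose $f:\Omega\to\mathbb{R}$ is a locally semiconvex function with linear modulus or a locally semiconcave function with linear modulus. Assume $x_0\in\Omega$ and $G$ is a bounded open subset of $\Omega$ such that $x_0\in G\subset\bar G\subset\Omega$. If $x_0$ is an Alexandrov point of $f$, then there is a constant $\Lambda>0$ such that for all $\lambda\ge\Lambda$, $$f(x_0)=C^u_\lambda(f_G)(x_0)=C^l_\lambda(f_G)(x_0)$$ and $$\nabla f(x_0)=\nabla C^u_\lambda(f_G)(x_0)=\nabla C^l_\lambda(f_G)(x_0).$$
   Context: $|\cdot|$ is the Euclidean norm on $\mathbb{R}^n$. $\mathsf{co}[F]$ denotes the convex envelope of $F:\mathbb{R}^n\to(-\infty,+\infty]$, i.e. the largest convex function not exceeding $F$. For $F:\mathbb{R}^n\to\mathbb{R}$ of linear growth and $\lambda>0$: the lower transform is $C^l_\lambda(F)(x)=\mathsf{co}[F+\lambda|\cdot|^2](x)-\lambda|x|^2$ and the upper transform is $C^u_\lambda(F)(x)=\lambda|x|^2-\mathsf{co}[\lambda|\cdot|^2-F](x)$. $f:\Omega\to\mathbb{R}$ is locally semiconvex (respectively, locally semiconcave) with linear modulus if for every convex compact subset $K\subset\Omega$ there are a constant $\lambda_K\ge0$ and a convex (respectively, concave) function $g_K:K\to\mathbb{R}$ such that $f(x)=g_K(x)-\lambda_K|x|^2$ (respectively, $f(x)=g_K(x)+\lambda_K|x|^2$) for $x\in K$. Such $f$ is Lipschitz on every compact subset of $\Omega$. $f_G:\mathbb{R}^n\to\mathbb{R}$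 denotes a Lipschitz extension of $f|_{\bar G}$ to $\mathbb{R}^n$ having the same Lipschitz constant as $f|_{\bar G}$ (it exists by Kirszbraun's theorem; any such extension may be used). $x_0\in\Omega$ is an Alexandrov point of $f$ if there are $p\in\mathbb{R}^n$ and a symmetric $n\times n$ matrix $B$ such that $$\lim_{x\to x_0}\frac{f(x)-f(x_0)-p\cdot(x-x_0)-(x-x_0)\cdot B(x-x_0)}{|x-x_0|^2}=0.$$ The gradient equalities include the assertion that the functions involved are differentiable at $x_0$. *)

theory Defs
  imports "HOL-Analysis.Analysis"
begin

text \<open>
  The convex envelope is the largest convex function not exceeding \<open>F\<close>, as a pointwise supremum of convex minorants.
  Only real-valued \<open>F\<close> are needed. The real supremum is meaningful as soon as \<open>F\<close> has some convex
  minorant; \<open>convex_envelope_greatest\<close> shows that it is then the greatest one, and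
  \<open>convex_minorant_linear_growth\<close> covers the functions to which the transforms are applied.
\<close>

definition convex_envelope :: "('a::real_vector \<Rightarrow> real) \<Rightarrow> 'a \<Rightarrow> real"
  where "convex_envelope F x =
    Sup {g x | g. convex_on UNIV g \<and> (\<forall>y. g y \<le> F y)}"

lemma convex_envelope_greatest:
  fixes F :: "'a::real_vector \<Rightarrow> real"
  assumes ex: "\<exists>g. convex_on UNIV g \<and> (\<forall>y. g y \<le> F y)"
  shows "convex_on UNIV (convex_envelope F)"
    and "convex_envelope F x \<le> F x"
    and "\<lbrakk>convex_on UNIV h; \<And>y. h y \<le> F y\<rbrakk> \<Longrightarrow> h x \<le> convex_envelope F x"
proof -
  let ?S = "\<lambda>x. {g x | g. convex_on UNIV g \<and> (\<forall>y. g y \<le> F y)}"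
  have ne: "?S x \<noteq> {}" for x using ex by blast
  have bdd: "bdd_above (?S x)" for x by (rule bdd_aboveI[of _ "F x"]) auto
  have upper: "h x \<le> convex_envelope F x" if "convex_on UNIV h" "\<And>y. h y \<le> F y" for h x
    unfolding convex_envelope_def using that by (intro cSup_upper bdd) blast
  show "\<lbrakk>convex_on UNIV h; \<And>y. h y \<le> F y\<rbrakk> \<Longrightarrow> h x \<le> convex_envelope F x"
    by (rule upper)
  show "convex_envelope F x \<le> F x"
    unfolding convex_envelope_def using ne by (intro cSup_least) auto
  show "convex_on UNIV (convex_envelope F)"
  proof (rule convex_onI)
    fix t :: real and x y :: 'a
    assume t: "0 < t" "t < 1"
    have "g ((1 - t) *\<^sub>R x + t *\<^sub>R y)
        \<le> (1 - t) * convex_envelope F x + t * convex_envelope F y"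
      if g: "convex_on UNIV g" "\<And>y. g y \<le> F y" for g
    proof -
      have "g ((1 - t) *\<^sub>R x + t *\<^sub>R y) \<le> (1 - t) * g x + t * g y"
        using convex_onD[OF g(1)] t by simp
      also have "\<dots> \<le> (1 - t) * convex_envelope F x + t * convex_envelope F y"
        using t g by (intro add_mono mult_left_mono upper) auto
      finally show ?thesis .
    qed
    then show "convex_envelope F ((1 - t) *\<^sub>R x + t *\<^sub>R y)
        \<le> (1 - t) * convex_envelope F x + t * convex_envelope F y"
      unfolding convex_envelope_def[of F "(1 - t) *\<^sub>R x + t *\<^sub>R y"]
      using ne by (intro cSup_least) auto
  qed simp
qed

lemma convex_minorant_linear_growth:
  fixes F :: "'a::real_normed_vector \<Rightarrow> real"
  assumes "lam > 0" and F: "\<And>x. \<bar>F x\<bar> \<le> A + B * norm x"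
  shows "\<exists>g. convex_on UNIV g \<and> (\<forall>y. g y \<le> F y + lam * (norm y)\<^sup>2)"
    and "\<exists>g. convex_on UNIV g \<and> (\<forall>y. g y \<le> lam * (norm y)\<^sup>2 - F y)"
proof -
  let ?c = "- A - B\<^sup>2 / (4 * lam)"
  have c: "?c \<le> lam * (norm y)\<^sup>2 - \<bar>F y\<bar>" for y
  proof -
    have "0 \<le> lam * (norm y - B / (2 * lam))\<^sup>2" using assms(1) by simp
    also have "\<dots> = lam * (norm y)\<^sup>2 - B * norm y + B\<^sup>2 / (4 * lam)"
      using assms(1) by (simp add: field_simps power2_eq_square)
    finally show ?thesis using F[of y] by linarith
  qed
  have "?c \<le> F y + lam * (norm y)\<^sup>2" "?c \<le> lam * (norm y)\<^sup>2 - F y" for y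
    using c[of y] by linarith+
  moreover have "convex_on (UNIV :: 'a set) (\<lambda>_. ?c)" by (simp add: convex_on_const)
  ultimately show "\<exists>g. convex_on UNIV g \<and> (\<forall>y. g y \<le> F y + lam * (norm y)\<^sup>2)"
    and "\<exists>g. convex_on UNIV g \<and> (\<forall>y. g y \<le> lam * (norm y)\<^sup>2 - F y)"
    by blast+
qed

definition lower_transform :: "real \<Rightarrow> ('a::real_normed_vector \<Rightarrow> real) \<Rightarrow> 'a \<Rightarrow> real"
  where "lower_transform lam F x =
    convex_envelope (\<lambda>y. F y + lam * (norm y)\<^sup>2) x - lam * (norm x)\<^sup>2"

definition upper_transform :: "real \<Rightarrow> ('a::real_normed_vector \<Rightarrow> real) \<Rightarrow> 'a \<Rightarrow> real"
  where "upper_transform lam F x =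
    lam * (norm x)\<^sup>2 - convex_envelope (\<lambda>y. lam * (norm y)\<^sup>2 - F y) x"

definition locally_semiconvex_on :: "'a::real_normed_vector set \<Rightarrow> ('a \<Rightarrow> real) \<Rightarrow> bool"
  where "locally_semiconvex_on \<Omega> f \<longleftrightarrow>
    (\<forall>K. convex K \<and> compact K \<and> K \<subseteq> \<Omega> \<longrightarrow>
      (\<exists>lam\<ge>0. \<exists>g. convex_on K g \<and> (\<forall>x\<in>K. f x = g x - lam * (norm x)\<^sup>2)))"

definition locally_semiconcave_on :: "'a::real_normed_vector set \<Rightarrow> ('a \<Rightarrow> real) \<Rightarrow> bool"
  where "locally_semiconcave_on \<Omega> f \<longleftrightarrow>
    (\<forall>K. convex K \<and> compact K \<and> K \<subseteq> \<Omega> \<longrightarrow>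
      (\<exists>lam\<ge>0. \<exists>g. concave_on K g \<and> (\<forall>x\<in>K. f x = g x + lam * (norm x)\<^sup>2)))"

text \<open>The least Lipschitz constant; meaningful only if \<open>f\<close> is Lipschitz on \<open>S\<close>.\<close>

definition lipschitz_const :: "'a::metric_space set \<Rightarrow> ('a \<Rightarrow> real) \<Rightarrow> real"
  where "lipschitz_const S f = Inf {L. L-lipschitz_on S f}"

definition lipschitz_extension :: "'a::metric_space set \<Rightarrow> ('a \<Rightarrow> real) \<Rightarrow> ('a \<Rightarrow> real) \<Rightarrow> bool"
  where "lipschitz_extension S f F \<longleftrightarrow>
    (\<forall>x\<in>S. F x = f x) \<and> (\<exists>L. L-lipschitz_on UNIV F) \<and>
    lipschitz_const UNIV F = lipschitz_const S f"

definition alexandrov_point ::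
    "(real ^ 'n) set \<Rightarrow> (real ^ 'n \<Rightarrow> real) \<Rightarrow> real ^ 'n \<Rightarrow> bool"
  where "alexandrov_point \<Omega> f x0 \<longleftrightarrow> x0 \<in> \<Omega> \<and>
    (\<exists>p. \<exists>B :: real ^ 'n ^ 'n. transpose B = B \<and>
      ((\<lambda>x. (f x - f x0 - p \<bullet> (x - x0) - (x - x0) \<bullet> (B *v (x - x0))) / (norm (x - x0))\<^sup>2)
        \<longlongrightarrow> 0) (at x0 within \<Omega>))"

end

(* At an Alexandrov point, f differs from its first-order Taylor polynomial by O(|x - x0|^2) near x0.
   Far from x0 the Lipschitz extension f_G grows only linearly, so a bound
   |f_G(x) - f(x0) - p.(x - x0)| <= Lambda |x - x0|^2 holds globally. For lam >= Lambda, subtracting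
   lam |x - x0|^2 from the Taylor polynomial and adding lam |x|^2 leaves an affine minorant of
   f_G + lam |.|^2 that touches it at x0. Hence the lower transform equals f(x0) at x0 and satisfies the
   same quadratic bound, which determines its gradient; the upper transform is dual. *)

theory Submission
  imports Defs
begin

text \<open>Dividing the bound by \<open>norm (x - x0)\<close> leaves
  \<open>C * norm (x - x0)\<close>, which tends to 0. This lemma yields all three gradients of the
  theorem.\<close>

lemma GDERIV_if_quadratic_remainder:
  assumes "\<forall>\<^sub>F x in at x0. \<bar>h x - h x0 - p \<bullet> (x - x0)\<bar> \<le> C * (norm (x - x0))\<^sup>2"
  shows "GDERIV h x0 :> p"
  unfolding gderiv_def has_derivative_at2
proof (intro conjI)
  show "bounded_linear (\<lambda>h. h \<bullet> p)"
    by (rule bounded_linear_inner_left)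
  have lim: "((\<lambda>x. C * norm (x - x0)) \<longlongrightarrow> 0) (at x0)"
    by (auto intro!: tendsto_eq_intros)
  have "\<forall>\<^sub>F x in at x0. norm ((1 / norm (x - x0)) *\<^sub>R (h x - (h x0 + (x - x0) \<bullet> p))) \<le> C * norm (x - x0)"
    using assms eventually_neq_at_within[of x0]
  proof eventually_elim
    case (elim x)
    then have "\<bar>h x - (h x0 + (x - x0) \<bullet> p)\<bar> \<le> C * norm (x - x0) * norm (x - x0)"
      by (simp add: power2_eq_square inner_commute mult.assoc diff_diff_eq)
    then show ?case
      using elim by (simp add: pos_divide_le_eq)
  qed
  then show "((\<lambda>x. (1 / norm (x - x0)) *\<^sub>R (h x - (h x0 + (x - x0) \<bullet> p))) \<longlongrightarrow> 0) (at x0)"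
    by (rule Lim_null_comparison[OF _ lim])
qed

lemma norm_diff_square:
  fixes x y :: "'a::real_inner"
  shows "(norm (x - y))\<^sup>2 = (norm x)\<^sup>2 - 2 * (x \<bullet> y) + (norm y)\<^sup>2"
  by (simp add: power2_norm_eq_inner inner_diff_left inner_diff_right inner_commute)

lemma convex_on_inner_affine: "convex_on UNIV (\<lambda>y. c + p \<bullet> y)"
  by (rule convex_onI) (simp_all add: algebra_simps inner_add_right)

text \<open>The envelope is squeezed between an affine minorant and
  \<open>F y + lam * (norm y)\<^sup>2\<close>. After \<open>lam * (norm x)\<^sup>2\<close> is
  subtracted, the lower bound is the Taylor polynomial minus
  \<open>lam * (norm (x - x0))\<^sup>2\<close> and the upper bound is \<open>F\<close> itself. The
  two meet at \<open>x0\<close>.\<close>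

lemma lower_transform_quadratic_remainder:
  fixes F :: "'a::real_inner \<Rightarrow> real"
  assumes F: "\<And>x. \<bar>F x - F x0 - p \<bullet> (x - x0)\<bar> \<le> lam * (norm (x - x0))\<^sup>2"
  shows "lower_transform lam F x0 = F x0"
    and "\<bar>lower_transform lam F x - F x0 - p \<bullet> (x - x0)\<bar> \<le> lam * (norm (x - x0))\<^sup>2"
proof -
  \<comment> \<open>Slope and constant term of the right-hand side of \<open>affine\<close>, in
    which the terms quadratic in \<open>y\<close> cancel.\<close>
  let ?q = "p + (2 * lam) *\<^sub>R x0"
  let ?c = "F x0 - p \<bullet> x0 - lam * (norm x0)\<^sup>2"
  let ?E = "convex_envelope (\<lambda>y. F y + lam * (norm y)\<^sup>2)"
  have affine: "?c + ?q \<bullet> y = F x0 + p \<bullet> (y - x0) - lam * (norm (y - x0))\<^sup>2 + lam * (norm y)\<^sup>2" for y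
    by (simp add: norm_diff_square inner_add_left inner_diff_right inner_commute algebra_simps)
  have minorant: "?c + ?q \<bullet> y \<le> F y + lam * (norm y)\<^sup>2" for y
    unfolding affine using F[of y] by linarith
  have ex: "\<exists>g. convex_on UNIV g \<and> (\<forall>y. g y \<le> F y + lam * (norm y)\<^sup>2)"
    using minorant convex_on_inner_affine by blast
  have upper: "?E y \<le> F y + lam * (norm y)\<^sup>2" for y
    by (rule convex_envelope_greatest(2)[OF ex])
  have lower: "?c + ?q \<bullet> y \<le> ?E y" for y
    by (rule convex_envelope_greatest(3)[OF ex convex_on_inner_affine minorant])
  show "lower_transform lam F x0 = F x0"
    using upper[of x0] lower[of x0] affine[of x0] unfolding lower_transform_def by simp
  show "\<bar>lower_transform lam F x - F x0 - p \<bullet> (x - x0)\<bar> \<le> lam * (norm (x - x0))\<^sup>2"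
    using upper[of x] lower[of x] affine[of x] F[of x] unfolding lower_transform_def by linarith
qed

lemma upper_transform_eq_lower: "upper_transform lam F x = - lower_transform lam (\<lambda>y. - F y) x"
  by (simp add: upper_transform_def lower_transform_def)

lemma upper_transform_quadratic_remainder:
  fixes F :: "'a::real_inner \<Rightarrow> real"
  assumes F: "\<And>x. \<bar>F x - F x0 - p \<bullet> (x - x0)\<bar> \<le> lam * (norm (x - x0))\<^sup>2"
  shows "upper_transform lam F x0 = F x0"
    and "\<bar>upper_transform lam F x - F x0 - p \<bullet> (x - x0)\<bar> \<le> lam * (norm (x - x0))\<^sup>2"
proof -
  \<comment> \<open>The two-sided bound survives a simultaneous change of sign of \<open>F\<close>
    and \<open>p\<close>, so the lower case applies to \<open>- F\<close>.\<close>
  have "\<bar>- F x - - F x0 - (- p) \<bullet> (x - x0)\<bar> \<le> lam * (norm (x - x0))\<^sup>2" for x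
    using F[of x] by (simp add: abs_le_iff)
  note neg = lower_transform_quadratic_remainder[where F = "\<lambda>y. - F y", OF this]
  show "upper_transform lam F x0 = F x0"
    using neg(1) by (simp add: upper_transform_eq_lower)
  show "\<bar>upper_transform lam F x - F x0 - p \<bullet> (x - x0)\<bar> \<le> lam * (norm (x - x0))\<^sup>2"
    using neg(2)[of x] by (simp add: upper_transform_eq_lower abs_le_iff)
qed

text \<open>The second-order term is itself at most quadratic in \<open>norm (x - x0)\<close>, by
  Cauchy-Schwarz and the operator norm of \<open>B\<close>, so it can be absorbed into the
  remainder.\<close>

lemma alexandrov_point_quadratic_remainder:
  fixes f :: "real ^ 'n \<Rightarrow> real"
  assumes "open \<Omega>" and "alexandrov_point \<Omega> f x0"
  obtains p C where "\<forall>\<^sub>F x in at x0. \<bar>f x - f x0 - p \<bullet> (x - x0)\<bar> \<le> C * (norm (x - x0))\<^sup>2"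
proof -
  obtain p and B :: "real ^ 'n ^ 'n" where "x0 \<in> \<Omega>" and
    lim: "((\<lambda>x. (f x - f x0 - p \<bullet> (x - x0) - (x - x0) \<bullet> (B *v (x - x0))) / (norm (x - x0))\<^sup>2)
        \<longlongrightarrow> 0) (at x0 within \<Omega>)"
    using assms(2) unfolding alexandrov_point_def by blast
  have at: "at x0 within \<Omega> = at x0"
    using \<open>x0 \<in> \<Omega>\<close> \<open>open \<Omega>\<close> by (rule at_within_open)
  have B: "\<bar>v \<bullet> (B *v v)\<bar> \<le> onorm ((*v) B) * (norm v)\<^sup>2" for v
  proof -
    have "\<bar>v \<bullet> (B *v v)\<bar> \<le> norm v * norm (B *v v)"
      by (rule Cauchy_Schwarz_ineq2)
    also have "\<dots> \<le> norm v * (onorm ((*v) B) * norm v)"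
      by (intro mult_left_mono onorm matrix_vector_mul_bounded_linear) simp
    finally show ?thesis
      by (simp add: power2_eq_square mult_ac)
  qed
  \<comment> \<open>The summand 1 comes from reading the limit with tolerance 1.\<close>
  have "\<forall>\<^sub>F x in at x0. \<bar>f x - f x0 - p \<bullet> (x - x0)\<bar> \<le> (1 + onorm ((*v) B)) * (norm (x - x0))\<^sup>2"
    using tendstoD[OF lim[unfolded at] zero_less_one] eventually_neq_at_within[of x0]
  proof eventually_elim
    case (elim x)
    then have "\<bar>f x - f x0 - p \<bullet> (x - x0) - (x - x0) \<bullet> (B *v (x - x0))\<bar> < (norm (x - x0))\<^sup>2"
      by (simp add: dist_real_def)
    then show ?case
      using B[of "x - x0"] by (simp only: distrib_right mult_1)
  qed
  then show thesis
    by (rule that)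
qed

text \<open>Outside a ball of radius \<open>r\<close> about \<open>x0\<close> the remainder grows at
  most linearly, and there \<open>norm (x - x0)\<close> is at most
  \<open>(norm (x - x0))\<^sup>2 / r\<close>.\<close>

lemma lipschitz_quadratic_remainder:
  fixes F :: "'a::real_inner \<Rightarrow> real"
  assumes near: "\<forall>\<^sub>F x in at x0. \<bar>F x - F x0 - p \<bullet> (x - x0)\<bar> \<le> C * (norm (x - x0))\<^sup>2"
    and lip: "L-lipschitz_on UNIV F"
  obtains M where "M > 0" and "\<And>x. \<bar>F x - F x0 - p \<bullet> (x - x0)\<bar> \<le> M * (norm (x - x0))\<^sup>2"
proof -
  obtain r where "r > 0" and
    r: "\<And>x. x \<noteq> x0 \<Longrightarrow> dist x x0 < r \<Longrightarrow> \<bar>F x - F x0 - p \<bullet> (x - x0)\<bar> \<le> C * (norm (x - x0))\<^sup>2"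
    using near unfolding eventually_at by blast
  have L: "0 \<le> L + norm p"
    using lipschitz_on_nonneg[OF lip] by simp
  \<comment> \<open>\<open>C\<close> serves inside the ball and \<open>(L + norm p) / r\<close>
    outside it; the 1 makes the constant positive.\<close>
  let ?M = "max 1 (max C ((L + norm p) / r))"
  have "\<bar>F x - F x0 - p \<bullet> (x - x0)\<bar> \<le> ?M * (norm (x - x0))\<^sup>2" for x
  proof (cases "x \<noteq> x0 \<and> dist x x0 < r")
    case True
    then have "\<bar>F x - F x0 - p \<bullet> (x - x0)\<bar> \<le> C * (norm (x - x0))\<^sup>2"
      using r by blast
    also have "\<dots> \<le> ?M * (norm (x - x0))\<^sup>2"
      by (intro mult_right_mono) auto
    finally show ?thesis .
  next
    case far: False
    show ?thesis
    proof (cases "x = x0")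
      case False
      with far have "r \<le> norm (x - x0)"
        by (simp add: dist_norm)
      have "\<bar>F x - F x0\<bar> \<le> L * norm (x - x0)"
        using lipschitz_onD[OF lip, of x x0] by (simp add: dist_norm)
      then have "\<bar>F x - F x0 - p \<bullet> (x - x0)\<bar> \<le> (L + norm p) * norm (x - x0)"
        using Cauchy_Schwarz_ineq2[of p "x - x0"] by (simp only: distrib_right)
      also have "\<dots> = (L + norm p) / r * (r * norm (x - x0))"
        using \<open>r > 0\<close> by simp
      also have "\<dots> \<le> (L + norm p) / r * (norm (x - x0))\<^sup>2"
        unfolding power2_eq_square using \<open>r > 0\<close> \<open>r \<le> norm (x - x0)\<close> L
        by (intro mult_left_mono mult_right_mono) auto
      also have "\<dots> \<le> ?M * (norm (x - x0))\<^sup>2"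
        by (intro mult_right_mono) auto
      finally show ?thesis .
    qed simp
  qed
  then show thesis
    by (intro that[of ?M]) auto
qed

theorem proposition1p10:
  fixes \<Omega> G :: "(real ^ 'n) set"
    and f f_G :: "real ^ 'n \<Rightarrow> real"
    and x0 :: "real ^ 'n"
  assumes "\<Omega> \<noteq> {}" and "open \<Omega>" and "convex \<Omega>"
    and "locally_semiconvex_on \<Omega> f \<or> locally_semiconcave_on \<Omega> f"
    and "x0 \<in> \<Omega>"
    and "bounded G" and "open G" and "x0 \<in> G" and "closure G \<subseteq> \<Omega>"
    and "lipschitz_extension (closure G) f f_G"
    and "alexandrov_point \<Omega> f x0"
  shows "\<exists>\<Lambda>>0. \<forall>lam\<ge>\<Lambda>.
    f x0 = upper_transform lam f_G x0 \<and>
    upper_transform lam f_G x0 = lower_transform lam f_G x0 \<and>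
    (\<exists>v. GDERIV f x0 :> v \<and>
         GDERIV (upper_transform lam f_G) x0 :> v \<and>
         GDERIV (lower_transform lam f_G) x0 :> v)"
proof -
  have ext: "f_G x = f x" if "x \<in> G" for x
    using assms(10) that closure_subset unfolding lipschitz_extension_def by blast
  obtain L where lip: "L-lipschitz_on UNIV f_G"
    using assms(10) unfolding lipschitz_extension_def by blast
  obtain p C where near: "\<forall>\<^sub>F x in at x0. \<bar>f x - f x0 - p \<bullet> (x - x0)\<bar> \<le> C * (norm (x - x0))\<^sup>2"
    using alexandrov_point_quadratic_remainder assms(2,11) by blast
  \<comment> \<open>\<open>G\<close> is a neighbourhood of \<open>x0\<close> on which
    \<open>f\<close> and \<open>f_G\<close> agree, so the local bound passes from \<open>f\<close>
    to \<open>f_G\<close>.\<close>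
  have "\<forall>\<^sub>F x in at x0. x \<in> G"
    using assms(7,8) by (rule eventually_at_in_open')
  with near have "\<forall>\<^sub>F x in at x0. \<bar>f_G x - f_G x0 - p \<bullet> (x - x0)\<bar> \<le> C * (norm (x - x0))\<^sup>2"
    by eventually_elim (simp add: ext assms(8))
  then obtain M where "M > 0" and
    M: "\<And>x. \<bar>f_G x - f_G x0 - p \<bullet> (x - x0)\<bar> \<le> M * (norm (x - x0))\<^sup>2"
    using lipschitz_quadratic_remainder lip by blast
  show ?thesis
  proof (intro exI[of _ M] conjI allI impI)
    fix lam
    assume "M \<le> lam"
    then have F: "\<bar>f_G x - f_G x0 - p \<bullet> (x - x0)\<bar> \<le> lam * (norm (x - x0))\<^sup>2" for x
      using M[of x] by (meson mult_right_mono order_trans zero_le_power2)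
    note low = lower_transform_quadratic_remainder[OF F]
    note upp = upper_transform_quadratic_remainder[OF F]
    show "f x0 = upper_transform lam f_G x0"
      by (simp add: upp(1) ext assms(8))
    show "upper_transform lam f_G x0 = lower_transform lam f_G x0"
      by (simp add: upp(1) low(1))
    \<comment> \<open>The first part of \<open>upp\<close> replaces \<open>f_G x0\<close> in the
      second by the value of the transform at \<open>x0\<close>, which gives the remainder of the
      transform itself. The same \<open>p\<close> then works for both transforms and for
      \<open>f\<close>.\<close>
    have "GDERIV (upper_transform lam f_G) x0 :> p"
      using upp by (intro GDERIV_if_quadratic_remainder[where C = lam] always_eventually) simp
    moreover have "GDERIV (lower_transform lam f_G) x0 :> p"
      using low by (intro GDERIV_if_quadratic_remainder[where C = lam] always_eventually) simp
    ultimately show "\<exists>v. GDERIV f x0 :> v \<and>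
         GDERIV (upper_transform lam f_G) x0 :> v \<and>
         GDERIV (lower_transform lam f_G) x0 :> v"
      using GDERIV_if_quadratic_remainder[OF near] by blast
  qed (rule \<open>M > 0\<close>)
qed

end
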